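(* Let $X\in\mathcal{COP}(p)$ with $T_0\ne\emptyset$, let $\{\tau(j), j\in J\}$ be the set of all normalized minimal zeros of $X$, and let $\{J(s), s\in S\}$ be the set of all (distinct) maximal cliques of the minimal zeros graph $G(X)$. Then the set $T_0$ of all normalized zeros of $X$ admits the representation $$T_0=\bigcup_{s\in S}T_0(s),\quad\text{where } T_0(s):=\operatorname{conv}\{\tau(j), j\in J(s)\},\ s\in S.$$
   Context: Let $p\ge 2$ be an integer, $P=\{1,\dots,p\}$, and let $e_k$ be the standard basis vectors of $\mathbb R^p$. $\mathcal{COP}(p)$ is the cone of copositive matrices: real symmetric $p\times p$ matrices $X$ with $t^\top Xt\ge 0$ for all $t\in\mathbb R^p$, $t\ge \mathbf 0$ (componentwise). $T=\{t\in\mathbb R^p: t\ge\mathbf 0, \|t\|_1=1\}$, and $T_0=\{t\in T: t^\top Xt=0\}$ is the set of normalized zeros of $X$. For $t\ge\mathbf 0$, $\operatorname{supp}(t)=\{k\in P: t_k>0\}$. A normalized zero $\tau\in T_0$ is minimal if there is no $t\in T_0$ with $\operatorname{supp}(t)$ a strict subset of $\operatorname{supp}(\tau)$. There are finitely many normalized minimal zeros; they are indexed without repetition as $\tau(j)$, $j\in J$, with $J\subset\mathbb N$ finite. Put $M(j):=\{k\in P: e_k^\top X\tau(j)=0\}$, $j\in J$. The minimal zeros graph $G(X)=(J,V)$ is the undirected graph with vertex set $J$ and edge set $V=\{(i,j): i\in J, j\in J, i<j, \operatorname{supp}(\tau(i))\subset M(j)\}$. A clique is a subset of the vertex set in which every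 two distinct vertices are adjacent (singletons are cliques); a maximal clique is a clique that is not a proper subset of another clique. The symbol $\subset$ allows equality. *)

theory Defs
  imports "HOL-Analysis.Analysis"
begin

definition copositive :: "real^'n^'n \<Rightarrow> bool" where
  "copositive X \<longleftrightarrow> transpose X = X \<and>
     (\<forall>t. (\<forall>k. 0 \<le> t $ k) \<longrightarrow> 0 \<le> t \<bullet> (X *v t))"

definition norm1 :: "real^'n \<Rightarrow> real" where
  "norm1 t = (\<Sum>k\<in>UNIV. \<bar>t $ k\<bar>)"

definition simplex_T :: "(real^'n) set" where
  "simplex_T = {t. (\<forall>k. 0 \<le> t $ k) \<and> norm1 t = 1}"

definition normalized_zeros :: "real^'n^'n \<Rightarrow> (real^'n) set" where
  "normalized_zeros X = {t \<in> simplex_T. t \<bullet> (X *v t) = 0}"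

text \<open>Only applied to vectors with nonnegative entries.\<close>

definition supp :: "real^'n \<Rightarrow> 'n set" where
  "supp t = {k. t $ k > 0}"

definition minimal_zeros :: "real^'n^'n \<Rightarrow> (real^'n) set" where
  "minimal_zeros X =
     {\<tau> \<in> normalized_zeros X. \<not> (\<exists>t \<in> normalized_zeros X. supp t \<subset> supp \<tau>)}"

definition M_set :: "real^'n^'n \<Rightarrow> real^'n \<Rightarrow> 'n set" where
  "M_set X t = {k. axis k 1 \<bullet> (X *v t) = 0}"

text \<open>Undirected graphs are pairs of a vertex set and an edge set; an undirected edge on
  vertices in \<open>nat\<close> is stored once, as the pair with the smaller endpoint first, so that
  adjacency has to consider both orders.\<close>

definition minimal_zeros_graph ::
    "real^'n^'n \<Rightarrow> nat set \<Rightarrow> (nat \<Rightarrow> real^'n) \<Rightarrow> nat set \<times> (nat \<times> nat) set" where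
  "minimal_zeros_graph X J \<tau> =
     (J, {(i, j). i \<in> J \<and> j \<in> J \<and> i < j \<and> supp (\<tau> i) \<subseteq> M_set X (\<tau> j)})"

definition adjacent :: "'v set \<times> ('v \<times> 'v) set \<Rightarrow> 'v \<Rightarrow> 'v \<Rightarrow> bool" where
  "adjacent G i j \<longleftrightarrow> (i, j) \<in> snd G \<or> (j, i) \<in> snd G"

definition clique :: "'v set \<times> ('v \<times> 'v) set \<Rightarrow> 'v set \<Rightarrow> bool" where
  "clique G C \<longleftrightarrow> C \<subseteq> fst G \<and> (\<forall>i\<in>C. \<forall>j\<in>C. i \<noteq> j \<longrightarrow> adjacent G i j)"

definition maximal_clique :: "'v set \<times> ('v \<times> 'v) set \<Rightarrow> 'v set \<Rightarrow> bool" where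
  "maximal_clique G C \<longleftrightarrow> clique G C \<and> \<not> (\<exists>D. clique G D \<and> C \<subset> D)"

end

theory Submission
  imports Defs
begin

text \<open>For a zero \<open>t\<close> of a copositive \<open>X\<close> the vector \<open>X t\<close> is nonnegative and vanishes on the support
  of \<open>t\<close>. Hence a zero \<open>\<tau>\<close> with \<open>supp \<tau> \<subseteq> supp t\<close> satisfies \<open>\<tau>\<^sup>T X t = 0\<close>, and the largest possible
  multiple of \<open>\<tau>\<close> can be subtracted from \<open>t\<close>, leaving a multiple of a zero of strictly smaller
  support. By induction, \<open>t\<close> is a convex combination of the minimal zeros supported in \<open>supp t\<close>.
  These form a clique: \<open>t\<^sup>T X \<tau> = 0\<close> is a sum of nonnegative terms, so \<open>X \<tau>\<close> vanishes on
  \<open>supp t\<close>. Conversely, the quadratic form vanishes on the convex hull of a clique because the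
  bilinear form vanishes on all pairs of its elements.\<close>

section \<open>The bilinear form on normalized zeros\<close>

lemma simplex_T_iff: "t \<in> simplex_T \<longleftrightarrow> (\<forall>k. 0 \<le> t $ k) \<and> (\<Sum>k\<in>UNIV. t $ k) = 1"
  by (auto simp: simplex_T_def norm1_def)

lemma convex_simplex_T: "convex (simplex_T :: (real^'n) set)"
  by (auto simp: convex_def simplex_T_iff sum.distrib sum_distrib_left[symmetric])

lemma normalized_zeros_iff:
  "t \<in> normalized_zeros X \<longleftrightarrow>
     (\<forall>k. 0 \<le> t $ k) \<and> (\<Sum>k\<in>UNIV. t $ k) = 1 \<and> t \<bullet> (X *v t) = 0"
  by (auto simp: normalized_zeros_def simplex_T_iff)

lemma copositive_inner_commute:
  assumes "copositive X"
  shows "x \<bullet> (X *v y) = y \<bullet> (X *v x)"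
  using assms by (metis copositive_def dot_lmul_matrix inner_commute transpose_matrix_vector)

lemma M_set_iff: "k \<in> M_set X t \<longleftrightarrow> (X *v t) $ k = 0"
  by (simp add: M_set_def inner_axis' inner_commute)

text \<open>All summands of the inner product are nonnegative, so it vanishes only termwise. This
  translates the support condition defining the edges into a bilinear equation.\<close>

lemma supp_subset_M_set_iff:
  assumes "\<And>k. 0 \<le> s $ k" "\<And>k. 0 \<le> (X *v t) $ k"
  shows "supp s \<subseteq> M_set X t \<longleftrightarrow> s \<bullet> (X *v t) = 0"
proof -
  have "s \<bullet> (X *v t) = 0 \<longleftrightarrow> (\<forall>k. s $ k * (X *v t) $ k = 0)"
    using assms by (simp add: inner_vec_def sum_nonneg_eq_0_iff)
  also have "\<dots> \<longleftrightarrow> supp s \<subseteq> M_set X t"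
    using assms(1) by (auto simp: supp_def M_set_iff order_less_le)
  finally show ?thesis by simp
qed

text \<open>A zero minimizes the quadratic form over the nonnegative orthant, so the directional
  derivative \<open>2 * (X *v t) $ k\<close> along each coordinate axis is nonnegative
  there.\<close>

lemma copositive_zero_mult_nonneg:
  assumes X: "copositive X" and t: "t \<in> normalized_zeros X"
  shows "0 \<le> (X *v t) $ k"
proof (rule ccontr)
  assume neg: "\<not> 0 \<le> (X *v t) $ k"
  define a where "a = (X *v t) $ k"
  define c where "c = axis k 1 \<bullet> (X *v axis k 1)"
  \<comment> \<open>The form at \<open>t + e *\<^sub>R axis k 1\<close> is
    \<open>2 * e * a + e\<^sup>2 * c\<close>. This step size gives \<open>e * c \<le> - a\<close>,
    so the linear term dominates and the value is negative; adding 1 keeps the denominator positive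
    when \<open>c = 0\<close>.\<close>
  define e where "e = - a / (\<bar>c\<bar> + 1)"
  have a: "a < 0" using neg by (simp add: a_def)
  then have e: "e > 0" unfolding e_def by (intro divide_pos_pos) auto
  have "0 \<le> (t + e *\<^sub>R axis k 1) $ i" for i
    using t e by (simp add: normalized_zeros_iff axis_def)
  then have "0 \<le> (t + e *\<^sub>R axis k 1) \<bullet> (X *v (t + e *\<^sub>R axis k 1))"
    using X unfolding copositive_def by blast
  also have "\<dots> = 2 * e * a + e\<^sup>2 * c"
    using t copositive_inner_commute[OF X, of t "axis k 1"]
    by (simp add: normalized_zeros_iff matrix_vector_right_distrib matrix_vector_mult_scaleR
        inner_add_left inner_add_right a_def c_def inner_axis' inner_axis power2_eq_square
        algebra_simps)
  also have "\<dots> = e * (2 * a + e * c)"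
    by (simp add: power2_eq_square algebra_simps)
  finally have "0 \<le> 2 * a + e * c"
    using e by (simp add: zero_le_mult_iff)
  moreover have "e * c \<le> e * (\<bar>c\<bar> + 1)"
    using e by (intro mult_left_mono) auto
  moreover have "e * (\<bar>c\<bar> + 1) = - a"
    by (simp add: e_def)
  ultimately show False using a by linarith
qed

lemma zero_inner_eq_0_if_supp_subset:
  assumes X: "copositive X" and s: "s \<in> normalized_zeros X" and t: "t \<in> normalized_zeros X"
    and "supp s \<subseteq> supp t"
  shows "s \<bullet> (X *v t) = 0"
proof -
  have "supp t \<subseteq> M_set X t"
    using supp_subset_M_set_iff[of t X t] copositive_zero_mult_nonneg[OF X t] t
    by (simp add: normalized_zeros_iff)
  then have "supp s \<subseteq> M_set X t" using assms(4) by blast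
  then show ?thesis
    using supp_subset_M_set_iff[of s X t] copositive_zero_mult_nonneg[OF X t] s
    by (simp add: normalized_zeros_iff)
qed

section \<open>Decomposition of a zero into minimal zeros\<close>

lemma obtain_minimal_zero:
  fixes X :: "real^'n^'n"
  assumes t: "t \<in> normalized_zeros X"
  obtains \<sigma> where "\<sigma> \<in> minimal_zeros X" "supp \<sigma> \<subseteq> supp t"
proof -
  \<comment> \<open>Minimality is sought among supports, of which there are finitely many, rather
    than among the possibly infinitely many zeros.\<close>
  let ?F = "{supp s |s. s \<in> normalized_zeros X \<and> supp s \<subseteq> supp t}"
  have "?F \<noteq> {}" using t by blast
  then obtain m where m: "m \<in> ?F" "\<forall>b\<in>?F. b \<subseteq> m \<longrightarrow> m = b"
    using finite_has_minimal[of ?F] by auto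
  then obtain \<sigma> where \<sigma>: "m = supp \<sigma>" "\<sigma> \<in> normalized_zeros X" "supp \<sigma> \<subseteq> supp t"
    by blast
  have "\<sigma> \<in> minimal_zeros X"
    unfolding minimal_zeros_def using m(2) \<sigma> by blast
  then show thesis using \<sigma>(3) that by blast
qed

text \<open>This is the descent step: only \<open>u\<close> remains to be decomposed, and its
  support is strictly smaller.\<close>

lemma zero_split_off:
  fixes X :: "real^'n^'n"
  assumes X: "copositive X" and s: "s \<in> normalized_zeros X" and t: "t \<in> normalized_zeros X"
    and sub: "supp s \<subseteq> supp t" and "s \<noteq> t"
  obtains l u where "u \<in> normalized_zeros X" "supp u \<subset> supp t" "0 \<le> l" "l \<le> 1"
    "t = l *\<^sub>R s + (1 - l) *\<^sub>R u"
proof -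
  have s0: "\<And>k. 0 \<le> s $ k" and s1: "(\<Sum>k\<in>UNIV. s $ k) = 1" and sX: "s \<bullet> (X *v s) = 0"
    using s by (auto simp: normalized_zeros_iff)
  have t0: "\<And>k. 0 \<le> t $ k" and t1: "(\<Sum>k\<in>UNIV. t $ k) = 1" and tX: "t \<bullet> (X *v t) = 0"
    using t by (auto simp: normalized_zeros_iff)
  have "supp s \<noteq> {}"
  proof
    assume "supp s = {}"
    then have "s $ k = 0" for k
      using s0[of k] by (auto simp: supp_def order_less_le)
    then show False using s1 by simp
  qed
  \<comment> \<open>The largest \<open>l\<close> for which \<open>t - l *\<^sub>R s\<close> stays
    nonnegative.\<close>
  define l where "l = Min ((\<lambda>k. t $ k / s $ k) ` supp s)"
  have "l \<in> (\<lambda>k. t $ k / s $ k) ` supp s"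
    unfolding l_def using \<open>supp s \<noteq> {}\<close> by (intro Min_in) auto
  then obtain k0 where k0: "k0 \<in> supp s" "l = t $ k0 / s $ k0" by blast
  have le: "l * s $ k \<le> t $ k" for k
  proof (cases "k \<in> supp s")
    case True
    then have "l \<le> t $ k / s $ k" unfolding l_def by (intro Min_le) auto
    with True show ?thesis by (simp add: supp_def pos_le_divide_eq)
  next
    case False
    then have "s $ k = 0" using s0[of k] by (auto simp: supp_def order_less_le)
    then show ?thesis using t0 by simp
  qed
  have l0: "0 \<le> l" using s0 t0 by (simp add: k0)
  define v where "v = t - l *\<^sub>R s"
  have v0: "0 \<le> v $ k" for k using le by (simp add: v_def)
  have v1: "(\<Sum>k\<in>UNIV. v $ k) = 1 - l"
    by (simp add: v_def sum_subtractf t1 s1 sum_distrib_left[symmetric])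
  have l1: "l \<le> 1" using v1 sum_nonneg[of UNIV "\<lambda>k. v $ k"] v0 by simp
  \<comment> \<open>With \<open>l = 1\<close> the nonnegative remainder has coordinate sum 0,
    forcing \<open>t = s\<close>. Excluding this permits the division by \<open>1 - l\<close>, the
    coordinate sum of \<open>v\<close>, that normalizes \<open>v\<close>.\<close>
  have "l \<noteq> 1"
  proof
    assume "l = 1"
    then have "v $ k = 0" for k
      using v1 v0 by (simp add: sum_nonneg_eq_0_iff)
    then have "t = s" using \<open>l = 1\<close> by (simp add: v_def vec_eq_iff)
    with \<open>s \<noteq> t\<close> show False by simp
  qed
  with l1 have l2: "0 < 1 - l" by simp
  have st: "s \<bullet> (X *v t) = 0" by (rule zero_inner_eq_0_if_supp_subset[OF X s t sub])
  have ts: "t \<bullet> (X *v s) = 0" using st copositive_inner_commute[OF X] by metis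
  have vX: "v \<bullet> (X *v v) = 0"
    by (simp add: v_def matrix_vector_mult_diff_distrib matrix_vector_mult_scaleR
        inner_diff_left inner_diff_right st ts sX tX)
  define u where "u = (1 / (1 - l)) *\<^sub>R v"
  have "u \<in> normalized_zeros X"
    using v0 v1 vX l2
    by (simp add: normalized_zeros_iff u_def matrix_vector_mult_scaleR
        sum_divide_distrib[symmetric])
  moreover have "supp u = supp v"
    using l2 by (simp add: supp_def u_def zero_less_divide_iff)
  moreover have "supp v \<subseteq> supp t"
  proof
    fix k assume "k \<in> supp v"
    moreover have "0 \<le> l * s $ k" using l0 s0 by simp
    ultimately show "k \<in> supp t" by (simp add: supp_def v_def)
  qed
  \<comment> \<open>At the index attaining the minimum the subtraction cancels the entry of
    \<open>t\<close> exactly, which makes the support inclusion strict.\<close>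
  moreover have "k0 \<notin> supp v" "k0 \<in> supp t"
    using k0 sub by (auto simp: supp_def v_def)
  moreover have "t = l *\<^sub>R s + (1 - l) *\<^sub>R u"
    using l2 by (simp add: u_def v_def)
  ultimately show thesis using that l0 l1 by blast
qed

text \<open>Restricting the hull to minimal zeros supported in \<open>supp t\<close> makes the hulls
  grow with the support, as the induction on its cardinality needs, and later makes the generators a
  clique.\<close>

lemma zero_in_hull_minimal_zeros:
  fixes X :: "real^'n^'n"
  assumes X: "copositive X" and "t \<in> normalized_zeros X"
  shows "t \<in> convex hull {\<sigma> \<in> minimal_zeros X. supp \<sigma> \<subseteq> supp t}"
  using assms(2)
proof (induction "card (supp t)" arbitrary: t rule: less_induct)
  case less
  let ?H = "\<lambda>t. convex hull {\<sigma> \<in> minimal_zeros X. supp \<sigma> \<subseteq> supp t}"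
  obtain \<sigma> where \<sigma>: "\<sigma> \<in> minimal_zeros X" "supp \<sigma> \<subseteq> supp t"
    using obtain_minimal_zero[OF less.prems] .
  have \<sigma>_in: "\<sigma> \<in> ?H t" using \<sigma> by (intro hull_inc) auto
  have \<sigma>_zero: "\<sigma> \<in> normalized_zeros X" using \<sigma> by (simp add: minimal_zeros_def)
  show ?case
  proof (cases "\<sigma> = t")
    case True
    then show ?thesis using \<sigma>_in by simp
  next
    case False
    obtain l u where u: "u \<in> normalized_zeros X" "supp u \<subset> supp t" "0 \<le> l" "l \<le> 1"
      "t = l *\<^sub>R \<sigma> + (1 - l) *\<^sub>R u"
      using zero_split_off[OF X \<sigma>_zero less.prems \<sigma>(2) False] .
    have "card (supp u) < card (supp t)" using u(2) by (intro psubset_card_mono) auto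
    then have "u \<in> ?H u" using less.hyps u(1) by blast
    also have "?H u \<subseteq> ?H t" using u(2) by (intro hull_mono) auto
    finally have "l *\<^sub>R \<sigma> + (1 - l) *\<^sub>R u \<in> ?H t"
      using \<sigma>_in u(3,4) by (intro convexD) auto
    then show ?thesis using u(5) by simp
  qed
qed

section \<open>Convex hulls of families on which the bilinear form vanishes\<close>

lemma bilinear_zero_on_hull:
  fixes X :: "real^'n^'n"
  assumes "\<And>x y. x \<in> A \<Longrightarrow> y \<in> A \<Longrightarrow> x \<bullet> (X *v y) = 0"
    and "x \<in> convex hull A" "y \<in> convex hull A"
  shows "x \<bullet> (X *v y) = 0"
proof -
  \<comment> \<open>The hull is taken in one argument at a time: for a fixed other argument the
    solution set is a linear subspace, hence convex.\<close>
  have right: "convex hull A \<subseteq> {y. a \<bullet> (X *v y) = 0}" if "a \<in> A" for a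
    using assms(1) that
    by (intro hull_minimal)
      (auto simp: convex_def matrix_vector_right_distrib matrix_vector_mult_scaleR inner_add_right)
  have "convex hull A \<subseteq> {x. x \<bullet> (X *v y) = 0}"
    using right assms(3) by (intro hull_minimal) (auto simp: convex_def inner_add_left)
  then show ?thesis using assms(2) by blast
qed

lemma hull_zeros_subset_normalized_zeros:
  fixes X :: "real^'n^'n"
  assumes "A \<subseteq> normalized_zeros X"
    and "\<And>x y. x \<in> A \<Longrightarrow> y \<in> A \<Longrightarrow> x \<bullet> (X *v y) = 0"
  shows "convex hull A \<subseteq> normalized_zeros X"
proof
  fix t assume t: "t \<in> convex hull A"
  have "convex hull A \<subseteq> simplex_T"
    using assms(1) convex_simplex_T by (intro hull_minimal) (auto simp: normalized_zeros_def)
  with t bilinear_zero_on_hull[OF assms(2) t t] show "t \<in> normalized_zeros X"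
    by (auto simp: normalized_zeros_def)
qed

section \<open>Cliques of the minimal zeros graph\<close>

lemma minimal_zeros_adjacent_iff:
  fixes X :: "real^'n^'n"
  assumes X: "copositive X" and \<tau>: "\<tau> ` J \<subseteq> minimal_zeros X"
    and ij: "i \<in> J" "j \<in> J" "i \<noteq> j"
  shows "adjacent (minimal_zeros_graph X J \<tau>) i j \<longleftrightarrow> \<tau> i \<bullet> (X *v \<tau> j) = 0"
proof -
  have zero: "\<tau> a \<in> normalized_zeros X" if "a \<in> J" for a
    using \<tau> that by (auto simp: minimal_zeros_def)
  have "supp (\<tau> a) \<subseteq> M_set X (\<tau> b) \<longleftrightarrow> \<tau> a \<bullet> (X *v \<tau> b) = 0" if "a \<in> J" "b \<in> J" for a b
    using zero that copositive_zero_mult_nonneg[OF X zero[OF that(2)]]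
    by (intro supp_subset_M_set_iff) (auto simp: normalized_zeros_iff)
  \<comment> \<open>An edge tests the supports in one order only, fixed by \<open>i < j\<close>;
    symmetry of \<open>X\<close> makes the resulting equation independent of that order.\<close>
  then show ?thesis
    using ij copositive_inner_commute[OF X, of "\<tau> i" "\<tau> j"]
    by (auto simp: adjacent_def minimal_zeros_graph_def)
qed

text \<open>The pairs with \<open>i = j\<close> may be included because each \<open>\<tau> i\<close>
  is itself a zero; the condition then has the form required for convex hulls.\<close>

lemma clique_minimal_zeros_iff:
  fixes X :: "real^'n^'n"
  assumes X: "copositive X" and \<tau>: "\<tau> ` J \<subseteq> minimal_zeros X"
  shows "clique (minimal_zeros_graph X J \<tau>) C \<longleftrightarrow>
    C \<subseteq> J \<and> (\<forall>i\<in>C. \<forall>j\<in>C. \<tau> i \<bullet> (X *v \<tau> j) = 0)"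
proof -
  have "\<tau> i \<bullet> (X *v \<tau> i) = 0" if "i \<in> J" for i
    using \<tau> that by (auto simp: minimal_zeros_def normalized_zeros_def)
  moreover have "fst (minimal_zeros_graph X J \<tau>) = J"
    by (simp add: minimal_zeros_graph_def)
  ultimately show ?thesis
    using minimal_zeros_adjacent_iff[OF X \<tau>] unfolding clique_def by (metis subsetD)
qed

lemma clique_supp_subset:
  fixes X :: "real^'n^'n"
  assumes X: "copositive X" and \<tau>: "\<tau> ` J \<subseteq> minimal_zeros X" and t: "t \<in> normalized_zeros X"
  shows "clique (minimal_zeros_graph X J \<tau>) {j \<in> J. supp (\<tau> j) \<subseteq> supp t}"
proof -
  have "\<tau> i \<bullet> (X *v \<tau> j) = 0"
    if ij: "i \<in> J" "supp (\<tau> i) \<subseteq> supp t" "j \<in> J" "supp (\<tau> j) \<subseteq> supp t" for i j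
  proof -
    have i: "\<tau> i \<in> normalized_zeros X" and j: "\<tau> j \<in> normalized_zeros X"
      using \<tau> ij by (auto simp: minimal_zeros_def)
    note nonneg = copositive_zero_mult_nonneg[OF X j]
    \<comment> \<open>The supports of \<open>\<tau> i\<close> and \<open>\<tau> j\<close> need not
      be nested, so the comparison goes through \<open>t\<close>, whose support contains
      both.\<close>
    have "t \<bullet> (X *v \<tau> j) = 0"
      using zero_inner_eq_0_if_supp_subset[OF X j t ij(4)] copositive_inner_commute[OF X] by metis
    then have "supp t \<subseteq> M_set X (\<tau> j)"
      using supp_subset_M_set_iff[of t X "\<tau> j"] nonneg t by (simp add: normalized_zeros_iff)
    then have "supp (\<tau> i) \<subseteq> M_set X (\<tau> j)" using ij(2) by blast
    then show ?thesis
      using supp_subset_M_set_iff[of "\<tau> i" X "\<tau> j"] nonneg i by (simp add: normalized_zeros_iff)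
  qed
  then show ?thesis unfolding clique_minimal_zeros_iff[OF X \<tau>] by blast
qed

lemma clique_extends_to_maximal:
  assumes "finite (fst G)" "clique G C"
  obtains D where "maximal_clique G D" "C \<subseteq> D"
proof -
  have "finite {D. clique G D}"
    by (rule finite_subset[of _ "Pow (fst G)"]) (use assms(1) in \<open>auto simp: clique_def\<close>)
  then obtain D where "C \<subseteq> D" "clique G D" "\<forall>E\<in>{D. clique G D}. D \<subseteq> E \<longrightarrow> D = E"
    using finite_has_maximal2[of "{D. clique G D}" C] assms(2) by auto
  then have "maximal_clique G D" unfolding maximal_clique_def by blast
  then show thesis using that \<open>C \<subseteq> D\<close> by blast
qed

theorem proposition3:
  fixes X :: "real^'n^'n"
    and J :: "nat set" and \<tau> :: "nat \<Rightarrow> real^'n"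
    and S :: "'s set" and Jc :: "'s \<Rightarrow> nat set"
  assumes "CARD('n) \<ge> 2"
    and "copositive X"
    and "normalized_zeros X \<noteq> {}"
    and "finite J"
    and "bij_betw \<tau> J (minimal_zeros X)"
    and "bij_betw Jc S {C. maximal_clique (minimal_zeros_graph X J \<tau>) C}"
  shows "normalized_zeros X = (\<Union>s\<in>S. convex hull (\<tau> ` Jc s))"
proof -
  let ?G = "minimal_zeros_graph X J \<tau>"
  have \<tau>: "\<tau> ` J = minimal_zeros X" using assms(5) by (rule bij_betw_imp_surj_on)
  then have \<tau>_sub: "\<tau> ` J \<subseteq> minimal_zeros X" by simp
  have Jc: "Jc ` S = {C. maximal_clique ?G C}" using assms(6) by (rule bij_betw_imp_surj_on)
  show ?thesis
  proof (intro equalityI subsetI)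
    fix t assume t: "t \<in> normalized_zeros X"
    let ?C = "{j \<in> J. supp (\<tau> j) \<subseteq> supp t}"
    have "finite (fst ?G)" using assms(4) by (simp add: minimal_zeros_graph_def)
    \<comment> \<open>The hull over \<open>?C\<close> already contains \<open>t\<close>; enlarging
      \<open>?C\<close> to a maximal clique only enlarges the hull.\<close>
    then obtain D where D: "maximal_clique ?G D" "?C \<subseteq> D"
      using clique_extends_to_maximal[OF _ clique_supp_subset[OF assms(2) \<tau>_sub t]] by metis
    then obtain s where s: "s \<in> S" "Jc s = D" using Jc by (metis (mono_tags) imageE mem_Collect_eq)
    have "{\<sigma> \<in> minimal_zeros X. supp \<sigma> \<subseteq> supp t} = \<tau> ` ?C"
      by (auto simp: \<tau>[symmetric])
    then have "t \<in> convex hull (\<tau> ` ?C)"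
      using zero_in_hull_minimal_zeros[OF assms(2) t] by simp
    also have "\<dots> \<subseteq> convex hull (\<tau> ` Jc s)"
      using D(2) s(2) by (intro hull_mono image_mono) simp
    finally show "t \<in> (\<Union>s\<in>S. convex hull (\<tau> ` Jc s))" using s(1) by blast
  next
    fix t assume "t \<in> (\<Union>s\<in>S. convex hull (\<tau> ` Jc s))"
    then obtain s where s: "s \<in> S" "t \<in> convex hull (\<tau> ` Jc s)" by blast
    then have "clique ?G (Jc s)" using Jc by (auto simp: maximal_clique_def)
    then have C: "Jc s \<subseteq> J" "\<forall>i\<in>Jc s. \<forall>j\<in>Jc s. \<tau> i \<bullet> (X *v \<tau> j) = 0"
      unfolding clique_minimal_zeros_iff[OF assms(2) \<tau>_sub] by auto
    have "convex hull (\<tau> ` Jc s) \<subseteq> normalized_zeros X"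
    proof (rule hull_zeros_subset_normalized_zeros)
      show "\<tau> ` Jc s \<subseteq> normalized_zeros X"
        using C(1) \<tau>_sub by (auto simp: minimal_zeros_def)
    qed (use C(2) in auto)
    then show "t \<in> normalized_zeros X" using s(2) by blast
  qed
qed

end
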